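(* Let $R$ be a commutative ring with $1\neq 0$ and let $T(R)$ be its total ring of fractions. Then $\widetilde{\Gamma}(R)=Z^{\star}(\Gamma(R))$ if and only if $T(R)$ is indecomposable.
   Context: For a commutative ring $R$ with $1\neq 0$, $Z(R)$ denotes the set of zero-divisors of $R$ (including $0$) and $Z(R)^{\star}=Z(R)\setminus\{0\}$. All graphs here are undirected simple graphs with vertex set $Z(R)^{\star}$. In $\widetilde{\Gamma}(R)$, distinct vertices $x,y$ are adjacent if and only if $xy=0$ or $x+y\in Z(R)$. In $Z^{\star}(\Gamma(R))$ (the subgraph of the total graph of $R$ induced on $Z(R)^{\star}$), distinct vertices $x,y$ are adjacent if and only if $x+y\in Z(R)$. Equality of graphs means they have the same edges. The total ring of fractions $T(R)$ is the localization of $R$ at the multiplicative set $R\setminus Z(R)$. A ring is indecomposable if it cannot be decomposed into a direct product of two nonzero rings. *)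

theory Defs
  imports "HOL-Algebra.Chinese_Remainder" "HOL-Algebra.QuotRing"
begin

text \<open>In a nonzero ring the element \<open>\<zero>\<close> is a zero-divisor in the following sense.\<close>

definition zero_divisors :: "('a, 'm) ring_scheme \<Rightarrow> 'a set"
  where "zero_divisors R =
    {x \<in> carrier R. \<exists>y \<in> carrier R. y \<noteq> \<zero>\<^bsub>R\<^esub> \<and> x \<otimes>\<^bsub>R\<^esub> y = \<zero>\<^bsub>R\<^esub>}"

definition nonzero_zero_divisors :: "('a, 'm) ring_scheme \<Rightarrow> 'a set"
  where "nonzero_zero_divisors R = zero_divisors R - {\<zero>\<^bsub>R\<^esub>}"

text \<open>Undirected simple graphs: edges are two-element sets of vertices.\<close>

record 'a sgraph =
  vertices :: "'a set"
  edges :: "'a set set"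

definition graph_of :: "'a set \<Rightarrow> ('a \<Rightarrow> 'a \<Rightarrow> bool) \<Rightarrow> 'a sgraph"
  where "graph_of V adj =
    \<lparr> vertices = V, edges = {{x, y} | x y. x \<in> V \<and> y \<in> V \<and> x \<noteq> y \<and> adj x y} \<rparr>"

definition induced_sgraph :: "'a sgraph \<Rightarrow> 'a set \<Rightarrow> 'a sgraph"
  where "induced_sgraph G W = \<lparr> vertices = W, edges = {e \<in> edges G. e \<subseteq> W} \<rparr>"

definition total_graph :: "('a, 'm) ring_scheme \<Rightarrow> 'a sgraph"
  where "total_graph R = graph_of (carrier R) (\<lambda>x y. x \<oplus>\<^bsub>R\<^esub> y \<in> zero_divisors R)"

text \<open>The graph $Z^{\star}(\Gamma(R))$.\<close>

definition zd_total_graph :: "('a, 'm) ring_scheme \<Rightarrow> 'a sgraph"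
  where "zd_total_graph R = induced_sgraph (total_graph R) (nonzero_zero_divisors R)"

text \<open>The graph $\widetilde{\Gamma}(R)$.\<close>

definition tilde_graph :: "('a, 'm) ring_scheme \<Rightarrow> 'a sgraph"
  where "tilde_graph R = graph_of (nonzero_zero_divisors R)
    (\<lambda>x y. x \<otimes>\<^bsub>R\<^esub> y = \<zero>\<^bsub>R\<^esub> \<or> x \<oplus>\<^bsub>R\<^esub> y \<in> zero_divisors R)"

lemma edge_tilde_graph_iff:
  assumes "cring R"
  shows "{x, y} \<in> edges (tilde_graph R) \<longleftrightarrow>
    x \<in> nonzero_zero_divisors R \<and> y \<in> nonzero_zero_divisors R \<and> x \<noteq> y \<and>
    (x \<otimes>\<^bsub>R\<^esub> y = \<zero>\<^bsub>R\<^esub> \<or> x \<oplus>\<^bsub>R\<^esub> y \<in> zero_divisors R)"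
proof -
  interpret cring R by fact
  have "u \<otimes>\<^bsub>R\<^esub> v = v \<otimes>\<^bsub>R\<^esub> u \<and> u \<oplus>\<^bsub>R\<^esub> v = v \<oplus>\<^bsub>R\<^esub> u"
    if "u \<in> nonzero_zero_divisors R" "v \<in> nonzero_zero_divisors R" for u v
    using that by (simp add: nonzero_zero_divisors_def zero_divisors_def m_comm a_comm)
  then show ?thesis
    unfolding tilde_graph_def graph_of_def by (auto simp: doubleton_eq_iff)
qed

lemma edge_zd_total_graph_iff:
  assumes "cring R"
  shows "{x, y} \<in> edges (zd_total_graph R) \<longleftrightarrow>
    x \<in> nonzero_zero_divisors R \<and> y \<in> nonzero_zero_divisors R \<and> x \<noteq> y \<and>
    x \<oplus>\<^bsub>R\<^esub> y \<in> zero_divisors R"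
proof -
  interpret cring R by fact
  have sub: "nonzero_zero_divisors R \<subseteq> carrier R"
    by (auto simp: nonzero_zero_divisors_def zero_divisors_def)
  show ?thesis
    using sub unfolding zd_total_graph_def induced_sgraph_def total_graph_def graph_of_def
    by (auto simp: doubleton_eq_iff a_comm)
qed

lemma tilde_graph_eq_iff_edges:
  "tilde_graph R = zd_total_graph R \<longleftrightarrow> edges (tilde_graph R) = edges (zd_total_graph R)"
  by (simp add: tilde_graph_def zd_total_graph_def graph_of_def induced_sgraph_def)

definition frac_rel :: "('a, 'm) ring_scheme \<Rightarrow> 'a set \<Rightarrow> (('a \<times> 'a) \<times> ('a \<times> 'a)) set"
  where "frac_rel R S = {((a, s), (b, t)) | a s b t.
    a \<in> carrier R \<and> s \<in> S \<and> b \<in> carrier R \<and> t \<in> S \<and>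
    (\<exists>u \<in> S. u \<otimes>\<^bsub>R\<^esub> (t \<otimes>\<^bsub>R\<^esub> a) = u \<otimes>\<^bsub>R\<^esub> (s \<otimes>\<^bsub>R\<^esub> b))}"

definition frac :: "('a, 'm) ring_scheme \<Rightarrow> 'a set \<Rightarrow> 'a \<Rightarrow> 'a \<Rightarrow> ('a \<times> 'a) set"
  where "frac R S a s = frac_rel R S `` {(a, s)}"

text \<open>
  The unions in the ring operations range over all representatives; they are unions of
  equal classes, see \<open>localization_mult\<close> and \<open>localization_add\<close> below.
\<close>

definition localization :: "('a, 'm) ring_scheme \<Rightarrow> 'a set \<Rightarrow> ('a \<times> 'a) set ring"
  where "localization R S =
    \<lparr> carrier = (carrier R \<times> S) // frac_rel R S,
      mult = (\<lambda>X Y. \<Union>(a, s) \<in> X. \<Union>(b, t) \<in> Y. frac R S (a \<otimes>\<^bsub>R\<^esub> b) (s \<otimes>\<^bsub>R\<^esub> t)),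
      one = frac R S \<one>\<^bsub>R\<^esub> \<one>\<^bsub>R\<^esub>,
      zero = frac R S \<zero>\<^bsub>R\<^esub> \<one>\<^bsub>R\<^esub>,
      add = (\<lambda>X Y. \<Union>(a, s) \<in> X. \<Union>(b, t) \<in> Y.
        frac R S (t \<otimes>\<^bsub>R\<^esub> a \<oplus>\<^bsub>R\<^esub> s \<otimes>\<^bsub>R\<^esub> b) (s \<otimes>\<^bsub>R\<^esub> t)) \<rparr>"

definition total_fractions :: "('a, 'm) ring_scheme \<Rightarrow> ('a \<times> 'a) set ring"
  where "total_fractions R = localization R (carrier R - zero_divisors R)"

locale multiplicative_set = cring R for R (structure) +
  fixes S :: "'a set"
  assumes S_sub: "S \<subseteq> carrier R"
    and S_one: "\<one> \<in> S"
    and S_mult: "s \<in> S \<Longrightarrow> t \<in> S \<Longrightarrow> s \<otimes> t \<in> S"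
begin

lemma S_carrier [simp]: "s \<in> S \<Longrightarrow> s \<in> carrier R"
  using S_sub by blast

lemma frac_rel_iff: "((a, s), (b, t)) \<in> frac_rel R S \<longleftrightarrow>
    a \<in> carrier R \<and> s \<in> S \<and> b \<in> carrier R \<and> t \<in> S \<and>
    (\<exists>u \<in> S. u \<otimes> (t \<otimes> a) = u \<otimes> (s \<otimes> b))"
  by (auto simp: frac_rel_def)

lemma equiv_frac_rel: "equiv (carrier R \<times> S) (frac_rel R S)"
proof (rule equivI)
  show "frac_rel R S \<subseteq> (carrier R \<times> S) \<times> (carrier R \<times> S)"
    by (auto simp: frac_rel_def)
  show "refl_on (carrier R \<times> S) (frac_rel R S)"
    using S_one by (auto simp: frac_rel_def refl_on_def)
  show "sym (frac_rel R S)"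
    by (auto simp: sym_def frac_rel_iff) metis
  show "trans (frac_rel R S)"
  proof (rule transI, clarify)
    fix a s b t c r
    assume "((a, s), (b, t)) \<in> frac_rel R S" "((b, t), (c, r)) \<in> frac_rel R S"
    then obtain u v where
      mem: "a \<in> carrier R" "b \<in> carrier R" "c \<in> carrier R"
        "s \<in> S" "t \<in> S" "r \<in> S" "u \<in> S" "v \<in> S"
      and u: "u \<otimes> (t \<otimes> a) = u \<otimes> (s \<otimes> b)" and v: "v \<otimes> (r \<otimes> b) = v \<otimes> (t \<otimes> c)"
      by (auto simp: frac_rel_iff)
    have "(t \<otimes> u \<otimes> v) \<otimes> (r \<otimes> a) = (v \<otimes> r) \<otimes> (u \<otimes> (t \<otimes> a))"
      using mem by (simp add: m_ac)
    also have "\<dots> = (u \<otimes> s) \<otimes> (v \<otimes> (r \<otimes> b))"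
      unfolding u using mem by (simp add: m_ac)
    also have "\<dots> = (t \<otimes> u \<otimes> v) \<otimes> (s \<otimes> c)"
      unfolding v using mem by (simp add: m_ac)
    finally show "((a, s), (c, r)) \<in> frac_rel R S"
      unfolding frac_rel_iff using mem S_mult by blast
  qed
qed

lemma frac_eq_iff:
  assumes "a \<in> carrier R" "b \<in> carrier R" "s \<in> S" "t \<in> S"
  shows "frac R S a s = frac R S b t \<longleftrightarrow> (\<exists>u \<in> S. u \<otimes> (t \<otimes> a) = u \<otimes> (s \<otimes> b))"
  using assms eq_equiv_class_iff[OF equiv_frac_rel, of "(a, s)" "(b, t)"]
  by (simp add: frac_def frac_rel_iff)

lemma localization_carrier:
  "carrier (localization R S) = {frac R S a s | a s. a \<in> carrier R \<and> s \<in> S}"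
  by (auto simp: localization_def quotient_def frac_def)

lemma localization_one: "\<one>\<^bsub>localization R S\<^esub> = frac R S \<one> \<one>"
  and localization_zero: "\<zero>\<^bsub>localization R S\<^esub> = frac R S \<zero> \<one>"
  by (simp_all add: localization_def)

lemma frac_self: "a \<in> carrier R \<Longrightarrow> s \<in> S \<Longrightarrow> (a, s) \<in> frac R S a s"
  using equiv_class_self[OF equiv_frac_rel] by (simp add: frac_def)

lemma Union_frac_const:
  assumes "a \<in> carrier R" "s \<in> S" "b \<in> carrier R" "t \<in> S"
    and "\<And>a' s' b' t'. ((a, s), (a', s')) \<in> frac_rel R S \<Longrightarrow>
      ((b, t), (b', t')) \<in> frac_rel R S \<Longrightarrow> F a' s' b' t' = F a s b t"
  shows "(\<Union>(a', s') \<in> frac R S a s. \<Union>(b', t') \<in> frac R S b t. F a' s' b' t') = F a s b t"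
    (is "?U = _")
proof (intro equalityI subsetI)
  fix x assume "x \<in> ?U"
  then obtain a' s' b' t' where
    "(a', s') \<in> frac R S a s" "(b', t') \<in> frac R S b t" "x \<in> F a' s' b' t'"
    by blast
  then show "x \<in> F a s b t"
    using assms(5)[of a' s' b' t'] by (simp add: frac_def)
next
  fix x assume "x \<in> F a s b t"
  then show "x \<in> ?U"
    using frac_self[OF assms(1,2)] frac_self[OF assms(3,4)] by blast
qed

lemma localization_mult:
  assumes "a \<in> carrier R" "s \<in> S" "b \<in> carrier R" "t \<in> S"
  shows "frac R S a s \<otimes>\<^bsub>localization R S\<^esub> frac R S b t = frac R S (a \<otimes> b) (s \<otimes> t)"
proof -
  have "frac R S (a' \<otimes> b') (s' \<otimes> t') = frac R S (a \<otimes> b) (s \<otimes> t)"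
    if rel: "((a, s), (a', s')) \<in> frac_rel R S" "((b, t), (b', t')) \<in> frac_rel R S" for a' s' b' t'
  proof -
    obtain u v where mem: "a' \<in> carrier R" "b' \<in> carrier R" "s' \<in> S" "t' \<in> S" "u \<in> S" "v \<in> S"
      and u: "u \<otimes> (s' \<otimes> a) = u \<otimes> (s \<otimes> a')" and v: "v \<otimes> (t' \<otimes> b) = v \<otimes> (t \<otimes> b')"
      using rel by (auto simp: frac_rel_iff)
    have "(u \<otimes> v) \<otimes> ((s \<otimes> t) \<otimes> (a' \<otimes> b')) = (u \<otimes> (s \<otimes> a')) \<otimes> (v \<otimes> (t \<otimes> b'))"
      using mem assms by (simp add: m_ac)
    also have "\<dots> = (u \<otimes> v) \<otimes> ((s' \<otimes> t') \<otimes> (a \<otimes> b))"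
      unfolding u[symmetric] v[symmetric] using mem assms by (simp add: m_ac)
    finally show ?thesis
      using mem assms S_mult by (subst frac_eq_iff) auto
  qed
  from Union_frac_const[where F = "\<lambda>a s b t. frac R S (a \<otimes> b) (s \<otimes> t)", OF assms this]
  show ?thesis by (simp add: localization_def)
qed

lemma localization_add:
  assumes "a \<in> carrier R" "s \<in> S" "b \<in> carrier R" "t \<in> S"
  shows "frac R S a s \<oplus>\<^bsub>localization R S\<^esub> frac R S b t =
    frac R S (t \<otimes> a \<oplus> s \<otimes> b) (s \<otimes> t)"
proof -
  have "frac R S (t' \<otimes> a' \<oplus> s' \<otimes> b') (s' \<otimes> t') = frac R S (t \<otimes> a \<oplus> s \<otimes> b) (s \<otimes> t)"
    if rel: "((a, s), (a', s')) \<in> frac_rel R S" "((b, t), (b', t')) \<in> frac_rel R S" for a' s' b' t'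
  proof -
    obtain u v where mem: "a' \<in> carrier R" "b' \<in> carrier R" "s' \<in> S" "t' \<in> S" "u \<in> S" "v \<in> S"
      and u: "u \<otimes> (s' \<otimes> a) = u \<otimes> (s \<otimes> a')" and v: "v \<otimes> (t' \<otimes> b) = v \<otimes> (t \<otimes> b')"
      using rel by (auto simp: frac_rel_iff)
    have "(u \<otimes> v) \<otimes> ((s \<otimes> t) \<otimes> (t' \<otimes> a' \<oplus> s' \<otimes> b')) =
        (v \<otimes> t \<otimes> t') \<otimes> (u \<otimes> (s \<otimes> a')) \<oplus> (u \<otimes> s \<otimes> s') \<otimes> (v \<otimes> (t \<otimes> b'))"
      using mem assms by (simp add: m_ac r_distr)
    also have "\<dots> = (u \<otimes> v) \<otimes> ((s' \<otimes> t') \<otimes> (t \<otimes> a \<oplus> s \<otimes> b))"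
      unfolding u[symmetric] v[symmetric] using mem assms by (simp add: m_ac r_distr)
    finally show ?thesis
      using mem assms S_mult by (subst frac_eq_iff) auto
  qed
  from Union_frac_const[where F = "\<lambda>a s b t. frac R S (t \<otimes> a \<oplus> s \<otimes> b) (s \<otimes> t)", OF assms this]
  show ?thesis by (simp add: localization_def)
qed

lemma frac_eqI:
  assumes "a \<in> carrier R" "b \<in> carrier R" "s \<in> S" "t \<in> S" "t \<otimes> a = s \<otimes> b"
  shows "frac R S a s = frac R S b t"
  using assms S_one by (subst frac_eq_iff) auto

lemma frac_carrier: "a \<in> carrier R \<Longrightarrow> s \<in> S \<Longrightarrow> frac R S a s \<in> carrier (localization R S)"
  by (auto simp: localization_carrier)

lemma localization_cases:
  assumes "X \<in> carrier (localization R S)"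
  obtains a s where "a \<in> carrier R" "s \<in> S" "X = frac R S a s"
  using assms by (auto simp: localization_carrier)

lemma cring_localization: "cring (localization R S)"
proof (rule cringI)
  let ?L = "localization R S"
  note ops = localization_add localization_mult localization_zero localization_one
    frac_carrier S_one S_mult
  show "abelian_group ?L"
  proof (rule abelian_groupI)
    fix X Y assume "X \<in> carrier ?L" "Y \<in> carrier ?L"
    then show "X \<oplus>\<^bsub>?L\<^esub> Y \<in> carrier ?L"
      by (elim localization_cases) (simp add: ops)
  next
    show "\<zero>\<^bsub>?L\<^esub> \<in> carrier ?L" by (simp add: ops)
  next
    fix X Y Z assume "X \<in> carrier ?L" "Y \<in> carrier ?L" "Z \<in> carrier ?L"
    then show "(X \<oplus>\<^bsub>?L\<^esub> Y) \<oplus>\<^bsub>?L\<^esub> Z = X \<oplus>\<^bsub>?L\<^esub> (Y \<oplus>\<^bsub>?L\<^esub> Z)"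
      by (elim localization_cases)
        (auto simp: ops m_ac a_ac r_distr intro!: frac_eqI)
  next
    fix X Y assume "X \<in> carrier ?L" "Y \<in> carrier ?L"
    then show "X \<oplus>\<^bsub>?L\<^esub> Y = Y \<oplus>\<^bsub>?L\<^esub> X"
      by (elim localization_cases)
        (auto simp: ops m_ac a_ac r_distr intro!: frac_eqI)
  next
    fix X assume "X \<in> carrier ?L"
    then show "\<zero>\<^bsub>?L\<^esub> \<oplus>\<^bsub>?L\<^esub> X = X"
      by (elim localization_cases) (auto simp: ops intro!: frac_eqI)
  next
    fix X assume "X \<in> carrier ?L"
    then obtain a s where as: "a \<in> carrier R" "s \<in> S" "X = frac R S a s"
      by (rule localization_cases)
    have "frac R S (\<ominus> a) s \<oplus>\<^bsub>?L\<^esub> X = \<zero>\<^bsub>?L\<^esub>"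
      unfolding as(3) using as(1,2)
      by (simp add: ops r_minus l_neg) (rule frac_eqI; simp add: ops)
    then show "\<exists>Y \<in> carrier ?L. Y \<oplus>\<^bsub>?L\<^esub> X = \<zero>\<^bsub>?L\<^esub>"
      using as frac_carrier by blast
  qed
  show "Group.comm_monoid ?L"
  proof (rule comm_monoidI)
    fix X Y assume "X \<in> carrier ?L" "Y \<in> carrier ?L"
    then show "X \<otimes>\<^bsub>?L\<^esub> Y \<in> carrier ?L" and "X \<otimes>\<^bsub>?L\<^esub> Y = Y \<otimes>\<^bsub>?L\<^esub> X"
      by (elim localization_cases; simp add: ops m_comm)+
  next
    show "\<one>\<^bsub>?L\<^esub> \<in> carrier ?L" by (simp add: ops)
  next
    fix X Y Z assume "X \<in> carrier ?L" "Y \<in> carrier ?L" "Z \<in> carrier ?L"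
    then show "(X \<otimes>\<^bsub>?L\<^esub> Y) \<otimes>\<^bsub>?L\<^esub> Z = X \<otimes>\<^bsub>?L\<^esub> (Y \<otimes>\<^bsub>?L\<^esub> Z)"
      by (elim localization_cases) (simp add: ops m_assoc)
  next
    fix X assume "X \<in> carrier ?L"
    then show "\<one>\<^bsub>?L\<^esub> \<otimes>\<^bsub>?L\<^esub> X = X"
      by (elim localization_cases) (simp add: ops)
  qed
  fix X Y Z assume "X \<in> carrier ?L" "Y \<in> carrier ?L" "Z \<in> carrier ?L"
  then show "(X \<oplus>\<^bsub>?L\<^esub> Y) \<otimes>\<^bsub>?L\<^esub> Z = X \<otimes>\<^bsub>?L\<^esub> Z \<oplus>\<^bsub>?L\<^esub> Y \<otimes>\<^bsub>?L\<^esub> Z"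
    apply (elim localization_cases)
    apply (simp add: ops)
    apply (rule frac_eqI)
    apply (simp_all add: ops m_ac a_ac r_distr l_distr)
    done
qed

end

lemma multiplicative_set_regular:
  assumes "cring R" and "\<one>\<^bsub>R\<^esub> \<noteq> \<zero>\<^bsub>R\<^esub>"
  shows "multiplicative_set R (carrier R - zero_divisors R)"
proof -
  interpret cring R by fact
  show ?thesis
  proof
    show "\<one>\<^bsub>R\<^esub> \<in> carrier R - zero_divisors R"
      by (auto simp: zero_divisors_def)
    fix s t assume "s \<in> carrier R - zero_divisors R" "t \<in> carrier R - zero_divisors R"
    then show "s \<otimes>\<^bsub>R\<^esub> t \<in> carrier R - zero_divisors R"
      by (auto simp: zero_divisors_def m_assoc)
  qed auto
qed

text \<open>
  The factors are required to live on the element type of \<open>R\<close>.  This is no restriction: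
  by \<open>indecomposable_ring_any_type\<close> below, an indecomposable ring has no decomposition
  with factors on arbitrary types either.
\<close>

definition indecomposable_ring :: "('a, 'm) ring_scheme \<Rightarrow> bool"
  where "indecomposable_ring R \<longleftrightarrow>
    \<not> (\<exists>(A :: 'a ring) (B :: 'a ring). ring A \<and> ring B \<and>
        carrier A \<noteq> {\<zero>\<^bsub>A\<^esub>} \<and> carrier B \<noteq> {\<zero>\<^bsub>B\<^esub>} \<and> R \<simeq> RDirProd A B)"

lemma transport_ring:
  assumes "ring A" and inj: "inj_on g (carrier A)"
  shows "g \<in> ring_iso A (image_ring g A)" "ring (image_ring g A)"
    "carrier A \<noteq> {\<zero>\<^bsub>A\<^esub>} \<Longrightarrow> carrier (image_ring g A) \<noteq> {\<zero>\<^bsub>image_ring g A\<^esub>}"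
proof -
  interpret ring A by fact
  show iso: "g \<in> ring_iso A (image_ring g A)"
    by (rule inj_imp_image_ring_iso[OF inj])
  show rg: "ring (image_ring g A)"
    by (rule ring.inj_imp_image_ring_is_ring[OF \<open>ring A\<close> inj])
  assume "carrier A \<noteq> {\<zero>\<^bsub>A\<^esub>}"
  then obtain x where x: "x \<in> carrier A" "x \<noteq> \<zero>\<^bsub>A\<^esub>"
    using zero_closed by blast
  then have "g x \<noteq> g \<zero>\<^bsub>A\<^esub>" using inj by (meson inj_onD zero_closed)
  moreover have "{g x, g \<zero>\<^bsub>A\<^esub>} \<subseteq> carrier (image_ring g A)"
    using x by (simp add: image_ring_carrier)
  ultimately show "carrier (image_ring g A) \<noteq> {\<zero>\<^bsub>image_ring g A\<^esub>}"
    by auto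
qed

lemma indecomposable_ring_any_type:
  fixes R :: "('a, 'm) ring_scheme" and A :: "('b, 'n) ring_scheme" and B :: "('c, 'k) ring_scheme"
  assumes "indecomposable_ring R" "ring A" "ring B" "R \<simeq> RDirProd A B"
  shows "carrier A = {\<zero>\<^bsub>A\<^esub>} \<or> carrier B = {\<zero>\<^bsub>B\<^esub>}"
proof (rule ccontr)
  assume "\<not> ?thesis"
  then have nz: "carrier A \<noteq> {\<zero>\<^bsub>A\<^esub>}" "carrier B \<noteq> {\<zero>\<^bsub>B\<^esub>}" by auto
  interpret A: ring A by fact
  interpret B: ring B by fact
  obtain f where f: "f \<in> ring_iso R (RDirProd A B)"
    using assms(4) by (auto simp: is_ring_iso_def)
  then have surj: "f ` carrier R = carrier A \<times> carrier B"
    by (auto simp: ring_iso_def bij_betw_def RDirProd_carrier)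
  define h where "h = inv_into (carrier R) f"
  have h: "f (h p) = p" if "p \<in> carrier A \<times> carrier B" for p
    unfolding h_def using that surj by (metis f_inv_into_f)
  have inj: "inj_on (\<lambda>a. h (a, \<zero>\<^bsub>B\<^esub>)) (carrier A)" "inj_on (\<lambda>b. h (\<zero>\<^bsub>A\<^esub>, b)) (carrier B)"
    by (rule inj_onI, metis h SigmaI A.zero_closed B.zero_closed prod.inject)+
  let ?A = "image_ring (\<lambda>a. h (a, \<zero>\<^bsub>B\<^esub>)) A" and ?B = "image_ring (\<lambda>b. h (\<zero>\<^bsub>A\<^esub>, b)) B"
  note tA = transport_ring[OF assms(2) inj(1)] and tB = transport_ring[OF assms(3) inj(2)]
  have "R \<simeq> RDirProd ?A ?B"
    using ring_iso_set_trans[OF f RDirProd_iso6[OF tA(1) tB(1)]] by (auto simp: is_ring_iso_def)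
  then show False
    using assms(1) tA(2,3) tB(2,3) nz unfolding indecomposable_ring_def by blast
qed

end

theory Submission
  imports Defs
begin

text \<open>
  Both properties fail exactly when a pair of nonzero orthogonal elements has a suitable sum.
  The graphs differ iff \<open>x y = 0\<close> for some nonzero \<open>x, y \<in> R\<close> with \<open>x + y\<close> regular, and
  \<open>T(R)\<close> splits iff \<open>e f = 0\<close> and \<open>e + f = 1\<close> for some nonzero \<open>e, f \<in> T(R)\<close>.  From
  \<open>x, y\<close> one obtains \<open>e = x / (x + y)\<close> and \<open>f = y / (x + y)\<close>; conversely, bringing \<open>e, f\<close> to
  a common denominator gives numerators whose product is zero and whose sum is regular.
\<close>

text \<open>If \<open>e \<oplus> f = \<one>\<close> and \<open>e \<otimes> f = \<zero>\<close>, the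
  ideals \<open>PIdl e\<close> and \<open>PIdl f\<close> are comaximal and meet in zero, so the
  Chinese remainder theorem splits \<open>R\<close> into its two quotients. Conversely, an
  isomorphism from a product carries the pairs (1, 0) and (0, 1) to such \<open>e\<close> and
  \<open>f\<close>.\<close>

lemma (in cring) indecomposable_ring_iff:
  "indecomposable_ring R \<longleftrightarrow>
    \<not> (\<exists>e \<in> carrier R. \<exists>f \<in> carrier R. e \<noteq> \<zero> \<and> f \<noteq> \<zero> \<and> e \<otimes> f = \<zero> \<and> e \<oplus> f = \<one>)"
proof (intro iffI notI)
  assume ind: "indecomposable_ring R"
  assume "\<exists>e \<in> carrier R. \<exists>f \<in> carrier R. e \<noteq> \<zero> \<and> f \<noteq> \<zero> \<and> e \<otimes> f = \<zero> \<and> e \<oplus> f = \<one>"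
  then obtain e f where ef: "e \<in> carrier R" "f \<in> carrier R" "e \<noteq> \<zero>" "f \<noteq> \<zero>"
      "e \<otimes> f = \<zero>" "e \<oplus> f = \<one>"
    by blast
  have ideals: "ideal (PIdl e) R" "ideal (PIdl f) R"
    using ef by (auto intro: cgenideal_ideal)
  \<comment> \<open>Multiplying \<open>e \<oplus> f = \<one>\<close> by \<open>x\<close> serves
    twice: it makes the two ideals comaximal and it makes their intersection trivial.\<close>
  have split: "x = x \<otimes> e \<oplus> x \<otimes> f" if "x \<in> carrier R" for x
    using ef that r_distr[of e f x] by simp
  have sum: "PIdl e <+> PIdl f = carrier R"
  proof
    show "PIdl e <+> PIdl f \<subseteq> carrier R"
      using ef by (auto simp: set_add_def' cgenideal_def)
    show "carrier R \<subseteq> PIdl e <+> PIdl f"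
    proof
      fix x assume x: "x \<in> carrier R"
      then have "x \<otimes> e \<in> PIdl e" "x \<otimes> f \<in> PIdl f"
        by (auto simp: cgenideal_def)
      then show "x \<in> PIdl e <+> PIdl f"
        unfolding set_add_def' using split[OF x] by blast
    qed
  qed
  have zero: "PIdl e \<inter> PIdl f = {\<zero>}"
  proof
    show "PIdl e \<inter> PIdl f \<subseteq> {\<zero>}"
    proof
      fix x assume "x \<in> PIdl e \<inter> PIdl f"
      then obtain a b where ab: "a \<in> carrier R" "b \<in> carrier R" "x = a \<otimes> e" "x = b \<otimes> f"
        by (auto simp: cgenideal_def)
      then have x: "x \<in> carrier R" using ef by simp
      \<comment> \<open>A common element is a multiple of \<open>f\<close>, hence killed by
        \<open>e\<close>, and a multiple of \<open>e\<close>, hence killed by \<open>f\<close>; both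
        summands in \<open>split\<close> vanish.\<close>
      have xe: "x \<otimes> e = \<zero>" unfolding ab(4) using ab(2) ef(1,2,5) by (simp add: m_assoc m_comm[of f e])
      have xf: "x \<otimes> f = \<zero>" unfolding ab(3) using ab(1) ef(1,2,5) by (simp add: m_assoc)
      show "x \<in> {\<zero>}" using split[OF x] unfolding xe xf by simp
    qed
    show "{\<zero>} \<subseteq> PIdl e \<inter> PIdl f"
      using ideals by (simp add: additive_subgroup.zero_closed ideal.axioms(1))
  qed
  \<comment> \<open>A zero quotient would make \<open>a\<close> a unit, which cannot annihilate a
    nonzero \<open>b\<close>. This is applied to the pair \<open>e\<close>, \<open>f\<close> in both
    orders.\<close>
  have nontrivial: "carrier (R Quot PIdl a) \<noteq> {\<zero>\<^bsub>R Quot PIdl a\<^esub>}"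
    if a: "a \<in> carrier R" "b \<in> carrier R" "b \<noteq> \<zero>" "a \<otimes> b = \<zero>" for a b
  proof
    interpret ideal "PIdl a" R using a(1) by (rule cgenideal_ideal)
    assume "carrier (R Quot PIdl a) = {\<zero>\<^bsub>R Quot PIdl a\<^esub>}"
    then have "PIdl a +> \<one> = PIdl a"
      by (auto simp: FactRing_def A_RCOSETS_def')
    then have "\<one> \<in> PIdl a"
      using rcos_const_imp_mem[OF one_closed] by blast
    then obtain c where c: "c \<in> carrier R" "\<one> = c \<otimes> a"
      unfolding cgenideal_def by blast
    have "b = \<one> \<otimes> b" using a(2) by simp
    also have "\<dots> = (c \<otimes> a) \<otimes> b" by (simp only: c(2))
    also have "\<dots> = \<zero>" using c(1) a by (simp add: m_assoc)
    finally show False using a(3) by simp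
  qed
  \<comment> \<open>By \<open>zero\<close>, the Chinese remainder isomorphism starts from the
    quotient of \<open>R\<close> by the zero ideal, which is \<open>R\<close> itself up to
    isomorphism.\<close>
  have "R \<simeq> RDirProd (R Quot PIdl e) (R Quot PIdl f)"
    using ring_iso_trans[OF FactRing_zeroideal(2)] chinese_remainder_simple[OF ideals sum]
    by (simp add: zero)
  \<comment> \<open>The elements of the quotients are cosets, so these factors do not live on the
    element type of \<open>R\<close>.\<close>
  from indecomposable_ring_any_type[OF ind ideals[THEN ideal.quotient_is_ring] this]
  show False
    using nontrivial[of e f] nontrivial[of f e] ef by (simp add: m_comm)
next
  assume orth: "\<not> (\<exists>e \<in> carrier R. \<exists>f \<in> carrier R. e \<noteq> \<zero> \<and> f \<noteq> \<zero> \<and> e \<otimes> f = \<zero> \<and> e \<oplus> f = \<one>)"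
  show "indecomposable_ring R"
    unfolding indecomposable_ring_def
  proof (intro notI, elim exE conjE)
    fix A B :: "'a ring"
    assume rings: "ring A" "ring B"
      and nz: "carrier A \<noteq> {\<zero>\<^bsub>A\<^esub>}" "carrier B \<noteq> {\<zero>\<^bsub>B\<^esub>}" and "R \<simeq> RDirProd A B"
    interpret A: ring A by fact
    interpret B: ring B by fact
    let ?P = "RDirProd A B"
    obtain h where h: "h \<in> ring_iso ?P R"
      using ring_iso_sym[OF ring_axioms \<open>R \<simeq> ?P\<close>] by (auto simp: is_ring_iso_def)
    interpret h: ring_hom_ring ?P R h
      using h RDirProd_ring[OF rings] ring_axioms by (simp add: ring_hom_ringI2 ring_iso_def)
    have P: "carrier ?P = carrier A \<times> carrier B" "\<zero>\<^bsub>?P\<^esub> = (\<zero>\<^bsub>A\<^esub>, \<zero>\<^bsub>B\<^esub>)"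
        "\<one>\<^bsub>?P\<^esub> = (\<one>\<^bsub>A\<^esub>, \<one>\<^bsub>B\<^esub>)"
        "(a, b) \<oplus>\<^bsub>?P\<^esub> (c, d) = (a \<oplus>\<^bsub>A\<^esub> c, b \<oplus>\<^bsub>B\<^esub> d)"
        "(a, b) \<otimes>\<^bsub>?P\<^esub> (c, d) = (a \<otimes>\<^bsub>A\<^esub> c, b \<otimes>\<^bsub>B\<^esub> d)" for a b c d
      by (simp_all add: RDirProd_def DirProd_def monoid.defs)
    have nonzero: "h p \<noteq> \<zero>" if "p \<in> carrier ?P" "p \<noteq> \<zero>\<^bsub>?P\<^esub>" for p
      using h that h.hom_zero h.R.zero_closed
      by (metis (no_types, lifting) bij_betw_def inj_onD ring_iso_memE(5))
    let ?e = "(\<one>\<^bsub>A\<^esub>, \<zero>\<^bsub>B\<^esub>)" and ?f = "(\<zero>\<^bsub>A\<^esub>, \<one>\<^bsub>B\<^esub>)"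
    have mem: "?e \<in> carrier ?P" "?f \<in> carrier ?P" by (simp_all add: P)
    have "\<one>\<^bsub>A\<^esub> \<noteq> \<zero>\<^bsub>A\<^esub>" "\<one>\<^bsub>B\<^esub> \<noteq> \<zero>\<^bsub>B\<^esub>"
      using nz A.one_zeroD B.one_zeroD by blast+
    then have "h ?e \<noteq> \<zero>" "h ?f \<noteq> \<zero>"
      using mem nonzero[of ?e] nonzero[of ?f] by (simp_all add: P)
    moreover have "h ?e \<otimes> h ?f = \<zero>"
      using mem h.hom_zero by (simp add: P flip: h.hom_mult)
    moreover have "h ?e \<oplus> h ?f = \<one>"
      using mem h.hom_one by (simp add: P flip: h.hom_add)
    ultimately show False
      using orth mem h.hom_closed by blast
  qed
qed

lemma (in cring) regular_mult_cancel:
  assumes "s \<in> carrier R - zero_divisors R" "a \<in> carrier R" "b \<in> carrier R"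
  shows "s \<otimes> a = s \<otimes> b \<longleftrightarrow> a = b"
proof
  assume "s \<otimes> a = s \<otimes> b"
  then have "s \<otimes> (a \<ominus> b) = \<zero>"
    using assms by (simp add: minus_eq r_distr r_minus r_neg)
  then have "a \<ominus> b = \<zero>"
    using assms by (auto simp: zero_divisors_def)
  moreover have "(a \<ominus> b) \<oplus> b = a"
    using assms by (simp add: minus_eq a_assoc l_neg)
  ultimately show "a = b"
    using assms by simp
qed simp

lemma (in cring) zero_divisors_mult:
  assumes "x \<in> zero_divisors R" "y \<in> carrier R"
  shows "x \<otimes> y \<in> zero_divisors R"
  using assms by (auto simp: zero_divisors_def) (metis m_assoc m_comm r_null)

text \<open>Every edge of \<open>zd_total_graph R\<close> is an edge of
  \<open>tilde_graph R\<close>, and an extra edge is precisely an orthogonal pair with regular sum.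
  Nonzero orthogonal elements annihilate each other, so they are vertices; the regular sum makes
  them distinct.\<close>

lemma (in cring) tilde_graph_eq_iff:
  "tilde_graph R = zd_total_graph R \<longleftrightarrow>
    \<not> (\<exists>x \<in> carrier R. \<exists>y \<in> carrier R. x \<noteq> \<zero> \<and> y \<noteq> \<zero> \<and> x \<otimes> y = \<zero> \<and>
        x \<oplus> y \<notin> zero_divisors R)"
    (is "_ \<longleftrightarrow> \<not> ?P")
proof (intro iffI notI)
  assume eq: "tilde_graph R = zd_total_graph R" and ?P
  then obtain x y where xy: "x \<in> carrier R" "y \<in> carrier R" "x \<noteq> \<zero>" "y \<noteq> \<zero>"
      "x \<otimes> y = \<zero>" "x \<oplus> y \<notin> zero_divisors R"
    by blast
  then have V: "x \<in> nonzero_zero_divisors R" "y \<in> nonzero_zero_divisors R"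
    by (auto simp: nonzero_zero_divisors_def zero_divisors_def m_comm)
  \<comment> \<open>If the two were equal, their sum would be a multiple of the zero-divisor
    \<open>x\<close>, hence itself a zero-divisor.\<close>
  have "x \<noteq> y"
  proof
    assume "x = y"
    then have "x \<oplus> y = x \<otimes> (\<one> \<oplus> \<one>)" using xy by (simp add: r_distr)
    then show False
      using xy V zero_divisors_mult[of x "\<one> \<oplus> \<one>"] by (simp add: nonzero_zero_divisors_def)
  qed
  then have "{x, y} \<in> edges (tilde_graph R)" "{x, y} \<notin> edges (zd_total_graph R)"
    using xy V by (simp_all add: edge_tilde_graph_iff edge_zd_total_graph_iff is_cring)
  then show False using eq by simp
next
  assume orth: "\<not> ?P"
  have iff: "{x, y} \<in> edges (tilde_graph R) \<longleftrightarrow> {x, y} \<in> edges (zd_total_graph R)" for x y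
  proof -
    have "u \<in> carrier R \<and> u \<noteq> \<zero>" if "u \<in> nonzero_zero_divisors R" for u
      using that by (simp add: nonzero_zero_divisors_def zero_divisors_def)
    then show ?thesis
      unfolding edge_tilde_graph_iff[OF is_cring] edge_zd_total_graph_iff[OF is_cring]
      using orth by blast
  qed
  \<comment> \<open>Since \<open>iff\<close> speaks only of edges written as \<open>{x, y}\<close>,
    comparing the edge sets requires every edge to have this form.\<close>
  have doubleton: "\<exists>x y. E = {x, y}" if "E \<in> edges (graph_of V adj)"
    for E V and adj :: "'a \<Rightarrow> 'a \<Rightarrow> bool"
    using that unfolding graph_of_def by simp blast
  have "edges (tilde_graph R) = edges (zd_total_graph R)"
  proof (intro equalityI subsetI)
    fix E assume E: "E \<in> edges (tilde_graph R)"
    then obtain x y where "E = {x, y}"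
      using doubleton unfolding tilde_graph_def by blast
    then show "E \<in> edges (zd_total_graph R)" using E iff by simp
  next
    fix E assume E: "E \<in> edges (zd_total_graph R)"
    then have "E \<in> edges (total_graph R)"
      by (simp add: zd_total_graph_def induced_sgraph_def)
    then obtain x y where "E = {x, y}"
      using doubleton unfolding total_graph_def by blast
    then show "E \<in> edges (tilde_graph R)" using E iff by simp
  qed
  then show "tilde_graph R = zd_total_graph R"
    by (simp add: tilde_graph_eq_iff_edges)
qed

lemma (in cring) total_fractions_orthogonal_iff:
  assumes "\<one> \<noteq> \<zero>"
  defines "T \<equiv> total_fractions R"
  shows "(\<exists>e \<in> carrier T. \<exists>f \<in> carrier T.
      e \<noteq> \<zero>\<^bsub>T\<^esub> \<and> f \<noteq> \<zero>\<^bsub>T\<^esub> \<and> e \<otimes>\<^bsub>T\<^esub> f = \<zero>\<^bsub>T\<^esub> \<and> e \<oplus>\<^bsub>T\<^esub> f = \<one>\<^bsub>T\<^esub>) \<longleftrightarrow>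
    (\<exists>x \<in> carrier R. \<exists>y \<in> carrier R.
      x \<noteq> \<zero> \<and> y \<noteq> \<zero> \<and> x \<otimes> y = \<zero> \<and> x \<oplus> y \<notin> zero_divisors R)"
    (is "?T \<longleftrightarrow> ?R")
proof -
  define S where "S = carrier R - zero_divisors R"
  interpret multiplicative_set R S
    unfolding S_def using multiplicative_set_regular[OF is_cring assms(1)] .
  have T: "T = localization R S"
    by (simp add: T_def total_fractions_def S_def)
  \<comment> \<open>All denominators are regular, so the factor \<open>u\<close> in
    \<open>frac_rel\<close> cancels and equality is plain cross-multiplication.\<close>
  have frac_eq: "frac R S a s = frac R S b t \<longleftrightarrow> t \<otimes> a = s \<otimes> b"
    if "a \<in> carrier R" "b \<in> carrier R" "s \<in> S" "t \<in> S" for a b s t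
    using that S_one by (subst frac_eq_iff) (auto simp: regular_mult_cancel S_def)
  have frac_0: "frac R S a s = \<zero>\<^bsub>T\<^esub> \<longleftrightarrow> a = \<zero>"
    and frac_1: "frac R S a s = \<one>\<^bsub>T\<^esub> \<longleftrightarrow> a = s"
    if "a \<in> carrier R" "s \<in> S" for a s
    using that S_one by (simp_all add: T localization_zero localization_one frac_eq)
  show ?thesis
  proof
    assume ?T
    then obtain e f where T_mem: "e \<in> carrier T" "f \<in> carrier T"
      and orth: "e \<noteq> \<zero>\<^bsub>T\<^esub>" "f \<noteq> \<zero>\<^bsub>T\<^esub>" "e \<otimes>\<^bsub>T\<^esub> f = \<zero>\<^bsub>T\<^esub>" "e \<oplus>\<^bsub>T\<^esub> f = \<one>\<^bsub>T\<^esub>"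
      by blast
    obtain a s where e: "a \<in> carrier R" "s \<in> S" "e = frac R S a s"
      using T_mem(1) unfolding T by (rule localization_cases)
    obtain b t where f: "b \<in> carrier R" "t \<in> S" "f = frac R S b t"
      using T_mem(2) unfolding T by (rule localization_cases)
    have mem: "a \<in> carrier R" "s \<in> S" "b \<in> carrier R" "t \<in> S"
      using e f by auto
    have ab: "a \<noteq> \<zero>" "b \<noteq> \<zero>" "a \<otimes> b = \<zero>" "t \<otimes> a \<oplus> s \<otimes> b = s \<otimes> t"
      using orth mem frac_0 frac_1 S_mult unfolding e(3) f(3)
      by (simp_all add: T localization_mult localization_add)
    \<comment> \<open>The witnesses are the numerators of \<open>e\<close> and \<open>f\<close> over
      the common denominator \<open>s \<otimes> t\<close>. They stay nonzero because
      \<open>s\<close> and \<open>t\<close> are regular, and by \<open>ab\<close> they add up to the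
      regular element \<open>s \<otimes> t\<close>.\<close>
    have "t \<otimes> a \<noteq> \<zero>" "s \<otimes> b \<noteq> \<zero>"
      using mem ab(1,2) regular_mult_cancel[of t a \<zero>] regular_mult_cancel[of s b \<zero>]
      by (simp_all add: S_def)
    moreover have "(t \<otimes> a) \<otimes> (s \<otimes> b) = (t \<otimes> s) \<otimes> (a \<otimes> b)"
      using mem by (simp add: m_ac)
    then have "(t \<otimes> a) \<otimes> (s \<otimes> b) = \<zero>"
      using mem ab(3) by simp
    moreover have "t \<otimes> a \<oplus> s \<otimes> b \<notin> zero_divisors R"
      using S_mult[of s t] mem unfolding ab(4) by (simp add: S_def)
    ultimately show ?R
      using mem by (meson S_carrier m_closed)
  next
    assume ?R
    then obtain x y where xy: "x \<in> carrier R" "y \<in> carrier R" "x \<noteq> \<zero>" "y \<noteq> \<zero>"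
        "x \<otimes> y = \<zero>" "x \<oplus> y \<in> S"
      by (auto simp: S_def)
    let ?s = "x \<oplus> y"
    let ?e = "frac R S x ?s" and ?f = "frac R S y ?s"
    have "?e \<otimes>\<^bsub>T\<^esub> ?f = \<zero>\<^bsub>T\<^esub>"
      using xy frac_0[of \<zero> "?s \<otimes> ?s"] S_mult by (simp add: T localization_mult)
    \<comment> \<open>Addition multiplies the denominators even when they agree, so the sum appears
      over \<open>?s \<otimes> ?s\<close>, with numerator
      \<open>?s \<otimes> x \<oplus> ?s \<otimes> y = ?s \<otimes> ?s\<close>.\<close>
    moreover have "?e \<oplus>\<^bsub>T\<^esub> ?f = frac R S (?s \<otimes> ?s) (?s \<otimes> ?s)"
      using xy by (simp add: T localization_add r_distr)
    then have "?e \<oplus>\<^bsub>T\<^esub> ?f = \<one>\<^bsub>T\<^esub>"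
      using xy frac_1[of "?s \<otimes> ?s" "?s \<otimes> ?s"] S_mult by simp
    moreover have "?e \<noteq> \<zero>\<^bsub>T\<^esub>" "?f \<noteq> \<zero>\<^bsub>T\<^esub>"
      using xy by (simp_all add: frac_0)
    moreover have "?e \<in> carrier T" "?f \<in> carrier T"
      using xy by (simp_all add: T frac_carrier)
    ultimately show ?T by blast
  qed
qed

theorem theorem2p6:
  fixes R :: "('a, 'm) ring_scheme"
  assumes "cring R" and "\<one>\<^bsub>R\<^esub> \<noteq> \<zero>\<^bsub>R\<^esub>"
  shows "tilde_graph R = zd_total_graph R \<longleftrightarrow> indecomposable_ring (total_fractions R)"
proof -
  interpret R: cring R by fact
  interpret T: cring "total_fractions R"
    unfolding total_fractions_def
    using multiplicative_set_regular[OF assms] by (rule multiplicative_set.cring_localization)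
  show ?thesis
    unfolding R.tilde_graph_eq_iff T.indecomposable_ring_iff
      R.total_fractions_orthogonal_iff[OF assms(2)] ..
qed

end
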